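(* Let $C_2=\{e,g\}$ be the cyclic group of order $2$ with identity $e$, and let $S_2$ be the semigroup with underlying set $\{1,2\}\times C_2\times\{1,2\}$ and multiplication $(i,x,\lambda)\cdot(j,y,\mu)=(i,x\,p_{\lambda j}\,y,\mu)$, where $p_{11}=p_{12}=p_{21}=e$ and $p_{22}=g$. Then $S_2$ is $2$-nilpotent.
   Context: $\mathbb{N}$ is the set of positive integers. Commutators. Let $\mathbf{A}$ be an algebra, $\operatorname{Con}(\mathbf{A})$ its congruence lattice with least element $0_A$ (equality) and greatest element $1_A=A\times A$, and $\operatorname{Pol}(\mathbf{A})$ its set of polynomial operations (operations built from the basic operations, variables and constants from $A$; for a semigroup, products of variables and constants). For tuples, $\mathbf{x}\;\alpha\;\mathbf{y}$ means coordinatewise relatedness. For $\alpha,\beta,\delta\in\operatorname{Con}(\mathbf{A})$, the condition $C(\alpha,\beta;\delta)$ means: for all $n,m\in\mathbb{N}$, every $p\in\operatorname{Pol}(\mathbf{A})$ of arity $n+m$, all $\mathbf{a},\mathbf{b}\in A^n$ with $\mathbf{a}\;\alpha\;\mathbf{b}$ and all $\mathbf{c},\mathbf{d}\in A^m$ with $\mathbf{c}\;\beta\;\mathbf{d}$, if $p(\mathbf{a},\mathbf{c})\;\delta\;p(\mathbf{a},\mathbf{d})$ then $p(\mathbf{b},\mathbf{c})\;\delta\;p(\mathbf{b},\mathbf{d})$. The commutator $[\alpha,\beta]$ is the smallest congruence $\delta$ with $C(\alpha,\beta;\delta)$. Put $(1_A,1_A]^{(1)}=[1_A,1_A]$ and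 $(1_A,1_A]^{(k+1)}=[1_A,(1_A,1_A]^{(k)}]$; $\mathbf{A}$ is $n$-nilpotent if $(1_A,1_A]^{(n)}=0_A$. In particular, $2$-nilpotent means $[1_A,[1_A,1_A]]=0_A$. *)

theory Defs
  imports "HOL-Algebra.Elementary_Groups"
begin

section \<open>Algebras, congruences and polynomial operations\<close>

text \<open>A basic operation is paired with its arity \<open>k\<close>; it takes its arguments as a list, and only
  its values on lists of length \<open>k\<close> over the universe are relevant.\<close>

record 'a alg =
  universe :: "'a set"
  basic_ops :: "(nat \<times> ('a list \<Rightarrow> 'a)) set"

definition wf_alg :: "'a alg \<Rightarrow> bool" where
  "wf_alg A \<longleftrightarrow> universe A \<noteq> {} \<and>
     (\<forall>(k, f) \<in> basic_ops A. \<forall>xs. length xs = k \<and> set xs \<subseteq> universe A \<longrightarrow> f xs \<in> universe A)"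

text \<open>Coordinatewise relatedness of tuples; in particular both tuples have the same length.\<close>

definition tuple_rel :: "('a \<times> 'a) set \<Rightarrow> 'a list \<Rightarrow> 'a list \<Rightarrow> bool" where
  "tuple_rel \<theta> xs ys \<longleftrightarrow> list_all2 (\<lambda>x y. (x, y) \<in> \<theta>) xs ys"

definition Con :: "'a alg \<Rightarrow> ('a \<times> 'a) set set" where
  "Con A = {\<theta>. equiv (universe A) \<theta> \<and>
     (\<forall>(k, f) \<in> basic_ops A. \<forall>xs ys. length xs = k \<and> length ys = k \<and> tuple_rel \<theta> xs ys
        \<longrightarrow> (f xs, f ys) \<in> \<theta>)}"

definition zero_cong :: "'a alg \<Rightarrow> ('a \<times> 'a) set" where
  "zero_cong A = Id_on (universe A)"

definition one_cong :: "'a alg \<Rightarrow> ('a \<times> 'a) set" where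
  "one_cong A = universe A \<times> universe A"

inductive_set Pol :: "'a alg \<Rightarrow> nat \<Rightarrow> ('a list \<Rightarrow> 'a) set"
  for A :: "'a alg" and n :: nat where
  Pol_var: "i < n \<Longrightarrow> (\<lambda>xs. xs ! i) \<in> Pol A n"
| Pol_const: "c \<in> universe A \<Longrightarrow> (\<lambda>_. c) \<in> Pol A n"
| Pol_op: "(k, f) \<in> basic_ops A \<Longrightarrow> length ps = k \<Longrightarrow> \<forall>p \<in> set ps. p \<in> Pol A n
    \<Longrightarrow> (\<lambda>xs. f (map (\<lambda>p. p xs) ps)) \<in> Pol A n"

section \<open>Commutators and nilpotence\<close>

definition centralizes ::
  "'a alg \<Rightarrow> ('a \<times> 'a) set \<Rightarrow> ('a \<times> 'a) set \<Rightarrow> ('a \<times> 'a) set \<Rightarrow> bool" where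
  "centralizes A \<alpha> \<beta> \<delta> \<longleftrightarrow>
     (\<forall>n \<ge> 1. \<forall>m \<ge> 1. \<forall>p \<in> Pol A (n + m). \<forall>a b c d.
        length a = n \<and> length b = n \<and> set a \<subseteq> universe A \<and> set b \<subseteq> universe A \<and> tuple_rel \<alpha> a b \<and>
        length c = m \<and> length d = m \<and> set c \<subseteq> universe A \<and> set d \<subseteq> universe A \<and> tuple_rel \<beta> c d
        \<longrightarrow> (p (a @ c), p (a @ d)) \<in> \<delta> \<longrightarrow> (p (b @ c), p (b @ d)) \<in> \<delta>)"

definition commutator :: "'a alg \<Rightarrow> ('a \<times> 'a) set \<Rightarrow> ('a \<times> 'a) set \<Rightarrow> ('a \<times> 'a) set" where
  "commutator A \<alpha> \<beta> = (LEAST \<delta>. \<delta> \<in> Con A \<and> centralizes A \<alpha> \<beta> \<delta>)"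

text \<open>The iterated commutator \<open>(1, 1]\<^sup>(\<^sup>k\<^sup>)\<close> for \<open>k \<ge> 1\<close>; the added value \<open>1\<close> at \<open>k = 0\<close> makes
  \<open>(1, 1]\<^sup>(\<^sup>1\<^sup>) = [1, 1]\<close> an instance of the recursion.\<close>

primrec iterated_commutator :: "'a alg \<Rightarrow> nat \<Rightarrow> ('a \<times> 'a) set" where
  "iterated_commutator A 0 = one_cong A"
| "iterated_commutator A (Suc k) = commutator A (one_cong A) (iterated_commutator A k)"

definition nilpotent :: "nat \<Rightarrow> 'a alg \<Rightarrow> bool" where
  "nilpotent n A \<longleftrightarrow> iterated_commutator A n = zero_cong A"

text \<open>The least element in the definition of the commutator exists.\<close>

lemma Pol_closed:
  assumes "wf_alg A" "p \<in> Pol A n" "length xs = n" "set xs \<subseteq> universe A"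
  shows "p xs \<in> universe A"
  using assms(2)
proof induction
  case (Pol_var i)
  then show ?case using assms(3,4) by (auto simp: subset_iff)
next
  case (Pol_const c)
  then show ?case .
next
  case (Pol_op k f ps)
  then have "length (map (\<lambda>p. p xs) ps) = k" "set (map (\<lambda>p. p xs) ps) \<subseteq> universe A"
    by auto
  then show ?case using Pol_op(1) assms(1) unfolding wf_alg_def by blast
qed

lemma one_cong_in_Con:
  assumes "wf_alg A"
  shows "one_cong A \<in> Con A"
proof -
  have "f xs \<in> universe A \<and> f ys \<in> universe A"
    if "(k, f) \<in> basic_ops A" "length xs = k" "length ys = k" "tuple_rel (one_cong A) xs ys"
    for k f xs ys
  proof -
    have "set xs \<subseteq> universe A" "set ys \<subseteq> universe A"
      using that(4) by (auto simp: tuple_rel_def one_cong_def list_all2_conv_all_nth in_set_conv_nth)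
    then show ?thesis using that assms unfolding wf_alg_def by blast
  qed
  moreover have "equiv (universe A) (one_cong A)"
    by (auto simp: one_cong_def equiv_def refl_on_def sym_def trans_def)
  ultimately show ?thesis unfolding Con_def one_cong_def by blast
qed

lemma commutator_eq_Inter:
  assumes "wf_alg A"
  shows "commutator A \<alpha> \<beta> = \<Inter>{\<delta> \<in> Con A. centralizes A \<alpha> \<beta> \<delta>}" (is "_ = \<Inter>?F")
    and "commutator A \<alpha> \<beta> \<in> Con A" and "centralizes A \<alpha> \<beta> (commutator A \<alpha> \<beta>)"
    and "\<And>\<delta>. \<delta> \<in> Con A \<Longrightarrow> centralizes A \<alpha> \<beta> \<delta> \<Longrightarrow> commutator A \<alpha> \<beta> \<subseteq> \<delta>"
proof -
  have "centralizes A \<alpha> \<beta> (one_cong A)"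
    unfolding centralizes_def
  proof (intro allI ballI impI, elim conjE)
    fix n m :: nat and p a b c d
    assume h: "p \<in> Pol A (n + m)" "length b = n" "set b \<subseteq> universe A"
      "length c = m" "length d = m" "set c \<subseteq> universe A" "set d \<subseteq> universe A"
    then show "(p (b @ c), p (b @ d)) \<in> one_cong A"
      using Pol_closed[OF assms h(1), of "b @ c"] Pol_closed[OF assms h(1), of "b @ d"]
      by (simp add: one_cong_def)
  qed
  then have ne: "one_cong A \<in> ?F" using one_cong_in_Con[OF assms] by simp
  have equivs: "equiv (universe A) \<delta>" if "\<delta> \<in> ?F" for \<delta> using that by (simp add: Con_def)
  have "equiv (universe A) (\<Inter>?F)"
  proof (rule equivI)
    show "\<Inter>?F \<subseteq> universe A \<times> universe A" using ne by (auto simp: one_cong_def)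
    show "refl_on (universe A) (\<Inter>?F)" using equivs unfolding equiv_def refl_on_def by blast
    show "sym (\<Inter>?F)"
      using equivs unfolding equiv_def by (intro symI) (blast dest: symD)
    show "trans (\<Inter>?F)"
      using equivs unfolding equiv_def by (intro transI) (blast dest: transD)
  qed
  moreover have "(f xs, f ys) \<in> \<Inter>?F"
    if "(k, f) \<in> basic_ops A" "length xs = k" "length ys = k" "tuple_rel (\<Inter>?F) xs ys" for k f xs ys
  proof
    fix \<delta> assume d: "\<delta> \<in> ?F"
    have "tuple_rel \<delta> xs ys"
      using that(4) d unfolding tuple_rel_def by (auto elim!: list_all2_mono)
    then show "(f xs, f ys) \<in> \<delta>" using that d unfolding Con_def by blast
  qed
  ultimately have con: "\<Inter>?F \<in> Con A" unfolding Con_def by blast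
  have cen: "centralizes A \<alpha> \<beta> (\<Inter>?F)"
  proof (subst centralizes_def, intro allI ballI impI InterI)
    fix n m :: nat and p a b c d \<delta>
    assume "n \<ge> 1" "m \<ge> 1" "p \<in> Pol A (n + m)"
      "length a = n \<and> length b = n \<and> set a \<subseteq> universe A \<and> set b \<subseteq> universe A \<and> tuple_rel \<alpha> a b \<and>
       length c = m \<and> length d = m \<and> set c \<subseteq> universe A \<and> set d \<subseteq> universe A \<and> tuple_rel \<beta> c d"
      "(p (a @ c), p (a @ d)) \<in> \<Inter>?F" and d: "\<delta> \<in> ?F"
    moreover from d have "centralizes A \<alpha> \<beta> \<delta>" by simp
    ultimately show "(p (b @ c), p (b @ d)) \<in> \<delta>"
      unfolding centralizes_def by blast
  qed
  show eq: "commutator A \<alpha> \<beta> = \<Inter>?F"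
    unfolding commutator_def
  proof (rule Least_equality)
    show "\<Inter>?F \<in> Con A \<and> centralizes A \<alpha> \<beta> (\<Inter>?F)" using con cen by (rule conjI)
    show "\<Inter>?F \<subseteq> \<delta>" if "\<delta> \<in> Con A \<and> centralizes A \<alpha> \<beta> \<delta>" for \<delta> using that by blast
  qed
  show "commutator A \<alpha> \<beta> \<in> Con A" "centralizes A \<alpha> \<beta> (commutator A \<alpha> \<beta>)"
    using con cen by (simp_all only: eq)
  show "\<And>\<delta>. \<delta> \<in> Con A \<Longrightarrow> centralizes A \<alpha> \<beta> \<delta> \<Longrightarrow> commutator A \<alpha> \<beta> \<subseteq> \<delta>"
    unfolding eq by blast
qed

section \<open>The semigroup \<open>S\<^sub>2\<close>\<close>

definition binary_alg :: "'a set \<Rightarrow> ('a \<Rightarrow> 'a \<Rightarrow> 'a) \<Rightarrow> 'a alg" where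
  "binary_alg S mul = \<lparr>universe = S, basic_ops = {(2, \<lambda>xs. mul (xs ! 0) (xs ! 1))}\<rparr>"

definition S2_sandwich :: "'g \<Rightarrow> 'g \<Rightarrow> nat \<Rightarrow> nat \<Rightarrow> 'g" where
  "S2_sandwich e g l j = (if l = 2 \<and> j = 2 then g else e)"

definition S2_carrier :: "('g, 'm) monoid_scheme \<Rightarrow> (nat \<times> 'g \<times> nat) set" where
  "S2_carrier C = {1, 2} \<times> carrier C \<times> {1, 2}"

definition S2_mult ::
  "('g, 'm) monoid_scheme \<Rightarrow> 'g \<Rightarrow> 'g \<Rightarrow> nat \<times> 'g \<times> nat \<Rightarrow> nat \<times> 'g \<times> nat \<Rightarrow> nat \<times> 'g \<times> nat" where
  "S2_mult C e g = (\<lambda>(i, x, l) (j, y, m).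
     (i, x \<otimes>\<^bsub>C\<^esub> S2_sandwich e g l j \<otimes>\<^bsub>C\<^esub> y, m))"

definition S2 :: "('g, 'm) monoid_scheme \<Rightarrow> 'g \<Rightarrow> 'g \<Rightarrow> (nat \<times> 'g \<times> nat) alg" where
  "S2 C e g = binary_alg (S2_carrier C) (S2_mult C e g)"

lemma S2_mult_closed:
  assumes "group C" "e \<in> carrier C" "g \<in> carrier C" "s \<in> S2_carrier C" "t \<in> S2_carrier C"
  shows "S2_mult C e g s t \<in> S2_carrier C"
proof -
  interpret group C by fact
  show ?thesis using assms by (auto simp: S2_mult_def S2_carrier_def S2_sandwich_def)
qed

lemma S2_mult_assoc:
  assumes "group C" "e \<in> carrier C" "g \<in> carrier C"
    and "s \<in> S2_carrier C" "t \<in> S2_carrier C" "u \<in> S2_carrier C"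
  shows "S2_mult C e g (S2_mult C e g s t) u = S2_mult C e g s (S2_mult C e g t u)"
proof -
  interpret group C by fact
  have "S2_sandwich e g l j \<in> carrier C" for l j using assms by (simp add: S2_sandwich_def)
  then show ?thesis using assms(4-6) by (auto simp: S2_mult_def S2_carrier_def m_assoc)
qed

lemma wf_alg_S2:
  assumes "group C" "e \<in> carrier C" "g \<in> carrier C"
  shows "wf_alg (S2 C e g)"
proof -
  have "S2_carrier C \<noteq> {}" using assms(2) by (auto simp: S2_carrier_def)
  moreover have "S2_mult C e g (xs ! 0) (xs ! 1) \<in> S2_carrier C"
    if "length xs = 2" "set xs \<subseteq> S2_carrier C" for xs
  proof (rule S2_mult_closed[OF assms])
    show "xs ! 0 \<in> S2_carrier C" "xs ! 1 \<in> S2_carrier C"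
      using nth_mem[of 0 xs] nth_mem[of 1 xs] that by (simp_all add: subsetD)
  qed
  ultimately show ?thesis by (simp add: wf_alg_def S2_def binary_alg_def)
qed

end

theory Submission
  imports Defs
begin

text \<open>
  Let \<open>H\<close> relate two triples with the same first and the same last coordinate; this is Green's
  relation \<open>\<H>\<close> of the Rees matrix semigroup \<open>S\<^sub>2\<close>. The series \<open>0 \<subseteq> H \<subseteq> 1\<close> is central:
  \<open>[1, 1] \<subseteq> H\<close> and \<open>[1, H] = 0\<close>, so \<open>[1, [1, 1]] = 0\<close> by monotonicity.

  The quotient by \<open>H\<close> is a rectangular band. There the first coordinate of a product is that of its
  leftmost factor, hence the first coordinate of a polynomial depends on at most one variable, and
  dually for the last coordinate. Such a function cannot violate the term condition, so
  \<open>[1, 1] \<subseteq> H\<close> (\<open>centralizes_green_H\<close>).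

  The group coordinate of a polynomial is the product of the group coordinates of its letters and
  of sandwich entries. Moving some arguments inside their \<open>H\<close>-classes leaves the sandwich entries
  unchanged. Since the group is commutative, the group coordinate of the value then changes by a
  factor that does not depend on the other arguments (\<open>Pol_middle_parallelogram\<close>); in particular,
  whether the value changes at all does not depend on them. Hence \<open>[1, H] = 0\<close>
  (\<open>centralizes_green_H_zero\<close>).

  The argument applies to these Rees matrix semigroups over any commutative group, and a cyclic
  group is commutative.
\<close>

section \<open>Congruences and polynomials of general algebras\<close>

lemma zero_cong_in_Con:
  assumes "wf_alg A"
  shows "zero_cong A \<in> Con A"
proof -
  have "(f xs, f ys) \<in> zero_cong A"
    if "(k, f) \<in> basic_ops A" "length xs = k" "tuple_rel (zero_cong A) xs ys" for k f xs ys
  proof -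
    have "xs = ys" and "set xs \<subseteq> universe A"
      using that(3)
      by (auto simp: tuple_rel_def zero_cong_def list_all2_conv_all_nth in_set_conv_nth Id_on_iff
          intro!: nth_equalityI)
    then show ?thesis
      using that(1,2) assms unfolding wf_alg_def zero_cong_def by blast
  qed
  moreover have "equiv (universe A) (zero_cong A)"
    by (auto simp: zero_cong_def equiv_def refl_on_def sym_def trans_def)
  ultimately show ?thesis unfolding Con_def by blast
qed

lemma centralizes_antimono:
  assumes "centralizes A \<alpha> \<beta> \<delta>" "\<beta>' \<subseteq> \<beta>"
  shows "centralizes A \<alpha> \<beta>' \<delta>"
proof -
  have "tuple_rel \<beta>' c d \<Longrightarrow> tuple_rel \<beta> c d" for c d
    using assms(2) unfolding tuple_rel_def by (auto elim!: list_all2_mono)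
  then show ?thesis using assms(1) unfolding centralizes_def by blast
qed

lemma tuple_rel_nth:
  assumes "tuple_rel \<theta> xs ys" "i < length xs"
  shows "(xs ! i, ys ! i) \<in> \<theta>"
  using assms by (simp add: tuple_rel_def list_all2_conv_all_nth)

lemma Pol_binary_induct [consumes 1, case_names var const mult]:
  assumes "p \<in> Pol (binary_alg S mul) n"
    and "\<And>i. i < n \<Longrightarrow> P (\<lambda>xs. xs ! i)"
    and "\<And>c. c \<in> S \<Longrightarrow> P (\<lambda>_. c)"
    and "\<And>p q. p \<in> Pol (binary_alg S mul) n \<Longrightarrow> q \<in> Pol (binary_alg S mul) n \<Longrightarrow> P p \<Longrightarrow> P q \<Longrightarrow>
      P (\<lambda>xs. mul (p xs) (q xs))"
  shows "P p"
  using assms(1)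
proof induction
  case (Pol_var i)
  then show ?case by (rule assms(2))
next
  case (Pol_const c)
  then show ?case using assms(3) by (simp add: binary_alg_def)
next
  case (Pol_op k f ps)
  then have f: "f = (\<lambda>xs. mul (xs ! 0) (xs ! 1))" and "length ps = 2"
    by (auto simp: binary_alg_def)
  then obtain p q where ps: "ps = [p, q]"
    by (auto simp: numeral_2_eq_2 length_Suc_conv)
  have "P (\<lambda>xs. mul (p xs) (q xs))"
    using Pol_op.IH ps by (intro assms(4)) auto
  then show ?case by (simp add: f ps)
qed

text \<open>If \<open>\<pi>\<close> turns the multiplication into a projection, then \<open>\<pi>\<close> of a polynomial depends on the
  single variable at the end of the word, or on none. That variable lies in only one of the two
  blocks of arguments, so the other block cannot influence it.\<close>

lemma Pol_projection_term_condition: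
  assumes "p \<in> Pol (binary_alg S mul) n" "length a = length b" "length c = length d"
    and "(\<forall>s t. \<pi> (mul s t) = \<pi> s) \<or> (\<forall>s t. \<pi> (mul s t) = \<pi> t)"
    and "\<pi> (p (a @ c)) = \<pi> (p (a @ d))"
  shows "\<pi> (p (b @ c)) = \<pi> (p (b @ d))"
  using assms(1,5)
proof (induction rule: Pol_binary_induct)
  case (var i)
  then show ?case using assms(2,3) by (simp add: nth_append split: if_splits)
next
  case (mult p q)
  then show ?case using assms(4) by auto
qed simp

section \<open>The relation \<open>\<H>\<close> of the Rees matrix semigroup\<close>

definition green_H :: "('g, 'm) monoid_scheme \<Rightarrow> ((nat \<times> 'g \<times> nat) \<times> (nat \<times> 'g \<times> nat)) set" where
  "green_H C = {(s, t). s \<in> S2_carrier C \<and> t \<in> S2_carrier C \<and>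
     fst s = fst t \<and> snd (snd s) = snd (snd t)}"

abbreviation middle :: "nat \<times> 'g \<times> nat \<Rightarrow> 'g" where
  "middle s \<equiv> fst (snd s)"

lemma fst_S2_mult: "fst (S2_mult C e g s t) = fst s"
  by (simp add: S2_mult_def split: prod.split)

lemma last_S2_mult: "snd (snd (S2_mult C e g s t)) = snd (snd t)"
  by (simp add: S2_mult_def split: prod.split)

lemma middle_S2_mult:
  "middle (S2_mult C e g s t) =
     middle s \<otimes>\<^bsub>C\<^esub> S2_sandwich e g (snd (snd s)) (fst t) \<otimes>\<^bsub>C\<^esub> middle t"
  by (simp add: S2_mult_def split: prod.split)

lemma middle_closed: "s \<in> S2_carrier C \<Longrightarrow> middle s \<in> carrier C"
  by (auto simp: S2_carrier_def)

lemma universe_S2: "universe (S2 C e g) = S2_carrier C"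
  by (simp add: S2_def binary_alg_def)

lemma Pol_S2_closed:
  assumes "group C" "e \<in> carrier C" "g \<in> carrier C" "p \<in> Pol (S2 C e g) n"
    and "length xs = n" "set xs \<subseteq> S2_carrier C"
  shows "p xs \<in> S2_carrier C"
  using Pol_closed[OF wf_alg_S2[OF assms(1-3)] assms(4,5)] assms(6) by (simp add: universe_S2)

lemma green_H_in_Con:
  assumes "group C" "e \<in> carrier C" "g \<in> carrier C"
  shows "green_H C \<in> Con (S2 C e g)"
proof -
  have "equiv (S2_carrier C) (green_H C)"
    by (auto simp: green_H_def equiv_def refl_on_def sym_def trans_def)
  moreover have "(S2_mult C e g (xs ! 0) (xs ! 1), S2_mult C e g (ys ! 0) (ys ! 1)) \<in> green_H C"
    if "length xs = 2" "tuple_rel (green_H C) xs ys" for xs ys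
    using tuple_rel_nth[OF that(2), of 0] tuple_rel_nth[OF that(2), of 1] that(1)
      S2_mult_closed[OF assms]
    by (simp add: green_H_def fst_S2_mult last_S2_mult)
  ultimately show ?thesis by (simp add: Con_def S2_def binary_alg_def)
qed

section \<open>Centrality of the two factors\<close>

lemma centralizes_green_H:
  assumes "group C" "e \<in> carrier C" "g \<in> carrier C"
  shows "centralizes (S2 C e g) \<alpha> \<beta> (green_H C)"
  unfolding centralizes_def
proof (intro allI ballI impI, elim conjE)
  fix n m :: nat and p a b c d
  assume p: "p \<in> Pol (S2 C e g) (n + m)"
    and len: "length a = n" "length b = n" "length c = m" "length d = m"
    and sets: "set b \<subseteq> universe (S2 C e g)" "set c \<subseteq> universe (S2 C e g)"
      "set d \<subseteq> universe (S2 C e g)"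
    and eq: "(p (a @ c), p (a @ d)) \<in> green_H C"
  have "\<pi> (p (b @ c)) = \<pi> (p (b @ d))"
    if "(\<forall>s t. \<pi> (S2_mult C e g s t) = \<pi> s) \<or> (\<forall>s t. \<pi> (S2_mult C e g s t) = \<pi> t)"
      "\<pi> (p (a @ c)) = \<pi> (p (a @ d))" for \<pi> :: "nat \<times> 'a \<times> nat \<Rightarrow> nat"
    using Pol_projection_term_condition[OF p[unfolded S2_def] _ _ that] len by simp
  from this[of fst] this[of "\<lambda>s. snd (snd s)"] eq
  show "(p (b @ c), p (b @ d)) \<in> green_H C"
    using len sets Pol_S2_closed[OF assms p, of "b @ c"] Pol_S2_closed[OF assms p, of "b @ d"]
    by (simp add: green_H_def fst_S2_mult last_S2_mult universe_S2)
qed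

lemma Pol_green_H:
  assumes "group C" "e \<in> carrier C" "g \<in> carrier C" "p \<in> Pol (S2 C e g) (n + m)"
    and "length a = n" "length c = m" "set a \<subseteq> S2_carrier C" "tuple_rel (green_H C) c d"
  shows "(p (a @ c), p (a @ d)) \<in> green_H C"
proof -
  have "tuple_rel (green_H C) a a"
    using assms(7) by (auto simp: tuple_rel_def green_H_def intro!: list.rel_refl_strong)
  then have rel: "tuple_rel (green_H C) (a @ c) (a @ d)"
    using assms(8) by (auto simp: tuple_rel_def intro: list_all2_appendI)
  show ?thesis
    using assms(4)[unfolded S2_def]
  proof (induction rule: Pol_binary_induct)
    case (var i)
    then show ?case using tuple_rel_nth[OF rel] assms(5,6) by simp
  next
    case (const s)
    then show ?case by (simp add: green_H_def)
  next
    case (mult p q)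
    then show ?case
      using S2_mult_closed[OF assms(1-3)] by (simp add: green_H_def fst_S2_mult last_S2_mult)
  qed
qed

lemma (in comm_group) middle_S2_mult_parallelogram:
  assumes "e \<in> carrier G" "g \<in> carrier G"
    and "(s, s') \<in> green_H G" "(u, u') \<in> green_H G" "(t, t') \<in> green_H G" "(v, v') \<in> green_H G"
    and "middle s \<otimes> middle t' = middle s' \<otimes> middle t"
    and "middle u \<otimes> middle v' = middle u' \<otimes> middle v"
  shows "middle (S2_mult G e g s u) \<otimes> middle (S2_mult G e g t' v') =
         middle (S2_mult G e g s' u') \<otimes> middle (S2_mult G e g t v)"
proof -
  let ?q = "S2_sandwich e g (snd (snd s)) (fst u)" and ?r = "S2_sandwich e g (snd (snd t)) (fst v)"
  have carr: "middle x \<in> carrier G" if "x \<in> {s, s', t, t', u, u', v, v'}" for x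
    using that assms(3-6) by (auto simp: green_H_def intro: middle_closed)
  have sandwich: "?q \<in> carrier G" "?r \<in> carrier G"
    using assms(1,2) by (auto simp: S2_sandwich_def)
  \<comment> \<open>Sandwich entries only see the outer coordinates, which agree within \<open>H\<close>-classes.\<close>
  have same: "snd (snd s') = snd (snd s)" "fst u' = fst u"
    "snd (snd t') = snd (snd t)" "fst v' = fst v"
    using assms(3-6) by (auto simp: green_H_def)
  have "(middle s \<otimes> ?q \<otimes> middle u) \<otimes> (middle t' \<otimes> ?r \<otimes> middle v') =
      (middle s \<otimes> middle t') \<otimes> (middle u \<otimes> middle v') \<otimes> (?q \<otimes> ?r)"
    using carr sandwich by (simp add: m_ac)
  also have "\<dots> = (middle s' \<otimes> middle t) \<otimes> (middle u' \<otimes> middle v) \<otimes> (?q \<otimes> ?r)"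
    by (simp only: assms(7,8))
  also have "\<dots> = (middle s' \<otimes> ?q \<otimes> middle u') \<otimes> (middle t \<otimes> ?r \<otimes> middle v)"
    using carr sandwich by (simp add: m_ac)
  finally show ?thesis by (simp add: middle_S2_mult same)
qed

text \<open>The equation says that the quotient of the group coordinates of \<open>p(a, c)\<close> and \<open>p(a, d)\<close> does
  not change when \<open>a\<close> is replaced by \<open>b\<close>. In this form, free of inverses, it is inherited by
  products: the equations of the two factors are multiplied, and the sandwich entries, which are
  the same for \<open>c\<close> and \<open>d\<close>, appear once on each side.\<close>

lemma (in comm_group) Pol_middle_parallelogram:
  assumes "e \<in> carrier G" "g \<in> carrier G" "p \<in> Pol (S2 G e g) (n + m)"
    and len: "length a = n" "length b = n" "length c = m" "length d = m"
    and sets: "set a \<subseteq> S2_carrier G" "set b \<subseteq> S2_carrier G"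
    and cd: "tuple_rel (green_H G) c d"
  shows "middle (p (a @ c)) \<otimes> middle (p (b @ d)) = middle (p (a @ d)) \<otimes> middle (p (b @ c))"
  using assms(3)[unfolded S2_def]
proof (induction rule: Pol_binary_induct)
  case (var i)
  show ?case
  proof (cases "i < n")
    case True
    then show ?thesis using len by (simp add: nth_append)
  next
    case False
    then have "(c ! (i - n), d ! (i - n)) \<in> green_H G"
      using tuple_rel_nth[OF cd] var len by simp
    then have "middle (c ! (i - n)) \<in> carrier G" "middle (d ! (i - n)) \<in> carrier G"
      by (auto simp: green_H_def intro: middle_closed)
    then show ?thesis using False len by (simp add: nth_append m_comm)
  qed
next
  case (const c)
  then show ?case by simp
next
  case (mult p q)
  have "(r (x @ c), r (x @ d)) \<in> green_H G"
    if "r \<in> {p, q}" "x \<in> {a, b}" for r x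
  proof -
    have "r \<in> Pol (S2 G e g) (n + m)" "length x = n" "set x \<subseteq> S2_carrier G"
      using that mult.hyps len sets unfolding S2_def by blast+
    then show ?thesis
      using Pol_green_H[OF is_group assms(1,2)] len(3) cd by blast
  qed
  then show ?case
    using mult.IH by (intro middle_S2_mult_parallelogram assms(1,2)) auto
qed

lemma (in comm_group) centralizes_green_H_zero:
  assumes "e \<in> carrier G" "g \<in> carrier G"
  shows "centralizes (S2 G e g) \<alpha> (green_H G) (zero_cong (S2 G e g))"
  unfolding centralizes_def
proof (intro allI ballI impI, elim conjE)
  fix n m :: nat and p a b c d
  assume p: "p \<in> Pol (S2 G e g) (n + m)"
    and len: "length a = n" "length b = n" "length c = m" "length d = m"
    and "set a \<subseteq> universe (S2 G e g)" "set b \<subseteq> universe (S2 G e g)"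
      "set c \<subseteq> universe (S2 G e g)" "set d \<subseteq> universe (S2 G e g)"
    and cd: "tuple_rel (green_H G) c d"
    and eq: "(p (a @ c), p (a @ d)) \<in> zero_cong (S2 G e g)"
  then have sets: "set a \<subseteq> S2_carrier G" "set b \<subseteq> S2_carrier G"
    "set c \<subseteq> S2_carrier G" "set d \<subseteq> S2_carrier G"
    by (simp_all add: universe_S2)
  have val: "p (x @ y) \<in> S2_carrier G" if "x \<in> {a, b}" "y \<in> {c, d}" for x y
    using that len sets by (intro Pol_S2_closed[OF is_group assms p]) auto
  have "middle (p (a @ c)) \<otimes> middle (p (b @ d)) = middle (p (a @ c)) \<otimes> middle (p (b @ c))"
    using Pol_middle_parallelogram[OF assms p len sets(1,2) cd] eq by (auto simp: zero_cong_def)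
  then have "middle (p (b @ c)) = middle (p (b @ d))"
    using val by (simp add: middle_closed)
  moreover have "(p (b @ c), p (b @ d)) \<in> green_H G"
    using Pol_green_H[OF is_group assms p len(2,3) sets(2) cd] .
  ultimately have "p (b @ c) = p (b @ d)"
    by (simp add: green_H_def prod_eq_iff)
  then show "(p (b @ c), p (b @ d)) \<in> zero_cong (S2 G e g)"
    using val by (simp add: zero_cong_def universe_S2 Id_on_iff)
qed

section \<open>Nilpotence\<close>

lemma (in comm_group) nilpotent_2_S2:
  assumes "e \<in> carrier G" "g \<in> carrier G"
  shows "nilpotent 2 (S2 G e g)"
proof -
  let ?A = "S2 G e g"
  let ?\<gamma> = "commutator ?A (one_cong ?A) (one_cong ?A)"
  let ?\<epsilon> = "commutator ?A (one_cong ?A) ?\<gamma>"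
  note wf = wf_alg_S2[OF is_group assms]
  have "?\<gamma> \<subseteq> green_H G"
    by (rule commutator_eq_Inter(4)[OF wf green_H_in_Con[OF is_group assms]
          centralizes_green_H[OF is_group assms]])
  then have "centralizes ?A (one_cong ?A) ?\<gamma> (zero_cong ?A)"
    by (rule centralizes_antimono[OF centralizes_green_H_zero[OF assms]])
  then have "?\<epsilon> \<subseteq> zero_cong ?A"
    by (rule commutator_eq_Inter(4)[OF wf zero_cong_in_Con[OF wf]])
  moreover have "zero_cong ?A \<subseteq> ?\<epsilon>"
  proof -
    have "equiv (universe ?A) ?\<epsilon>"
      using commutator_eq_Inter(2)[OF wf, of "one_cong ?A" ?\<gamma>] by (simp add: Con_def)
    then show ?thesis by (auto simp: zero_cong_def equiv_def refl_on_def)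
  qed
  ultimately show ?thesis by (simp add: nilpotent_def numeral_2_eq_2)
qed

theorem proposition3p10:
  fixes C\<^sub>2 :: "('g, 'm) monoid_scheme" and e g :: 'g
  assumes "group C\<^sub>2" and "cyclic_group C\<^sub>2" and "order C\<^sub>2 = 2"
    and "carrier C\<^sub>2 = {e, g}" and "e = \<one>\<^bsub>C\<^sub>2\<^esub>"
  shows "nilpotent 2 (S2 C\<^sub>2 e g)"
proof -
  have "comm_group C\<^sub>2"
    using assms(1,2) by (rule group.cyclic_imp_abelian_group)
  then show ?thesis
    using assms(4) by (intro comm_group.nilpotent_2_S2) auto
qed

end
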